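(* Let $A\in\mathbb{C}^{n\times n}$, let $\mathbf{b}\in\mathbb{C}^n$ be nonzero, let $N$ be the Arnoldi termination index of $(A,\mathbf{b})$, let $\delta\in\mathbb{C}$ and $1\le k\le N-1$. With $H_k$, $Q_k(\delta)$, $s_k(\delta)$, $c_k(\delta)$, the Arnoldi vectors $\mathbf{v}_k$ and the normalized GMRES residuals $\mathbf{w}_{k-1}(\delta)$ as in the context, define $$\tau_k(\delta)=\mathbf{e}_k^*\,Q_k(\delta)^*\,(H_k-\delta I_k)\,\mathbf{e}_k.$$ Then $$\tau_k(\delta)=(-1)^{k-1}\,\mathbf{w}_{k-1}(\delta)^*(A-\delta I_n)\mathbf{v}_k,$$ and $$s_k(\delta)=\frac{h_{k+1,k}}{\sqrt{h_{k+1,k}^2+|\tau_k(\delta)|^2}}\qquad\text{and}\qquad c_k(\delta)=\frac{\tau_k(\delta)}{\sqrt{h_{k+1,k}^2+|\tau_k(\delta)|^2}}.$$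
   Context: Arnoldi process: starting from $\mathbf{v}_1=\mathbf{b}/\|\mathbf{b}\|$, the Arnoldi process produces orthonormal vectors $\mathbf{v}_1,\mathbf{v}_2,\dots$ and scalars $h_{j,k}=\mathbf{v}_j^*A\mathbf{v}_k$ with $A\mathbf{v}_k=\sum_{j=1}^{k+1}h_{j,k}\mathbf{v}_j$, $h_{k+1,k}\ge 0$. It terminates at the Arnoldi termination index $N\le n$, the first index for which $\mathbf{v}_{N+1}=0$; thus $h_{k+1,k}>0$ for $1\le k\le N-1$. $H_N=(h_{i,j})_{i,j=1}^N$ is the resulting upper Hessenberg matrix ($h_{i,j}=0$ for $i>j+1$) and $H_k$ its leading $k\times k$ principal submatrix. $\underline{I}_k\in\mathbb{C}^{(k+1)\times k}$ consists of the first $k$ columns of $I_{k+1}$, and $\underline{H}_k=H_{k+1}\underline{I}_k$. QR factor: $Q_1(\delta)=[1]$ and, for $1\le k\le N-1$, $$Q_{k+1}(\delta)^*=\begin{bmatrix}I_{k-1}&0&0\\0&\overline{c_k(\delta)}&s_k(\delta)\\0&-s_k(\delta)&c_k(\delta)\end{bmatrix}\begin{bmatrix}Q_k(\delta)^*&0\\0&1\end{bmatrix},$$ where $c_k(\delta)\in\mathbb{C}$, $s_k(\delta)\ge 0$, $s_k(\delta)^2+|c_k(\delta)|^2=1$ are the (unique) parameters such that $Q_{k+1}(\delta)^*(\underline{H}_k-\delta\underline{I}_k)=\begin{bmatrix}R_k(\delta)\\0\end{bmatrix}$ with $R_k(\delta)$ upper triangular with positive real diagonal entries. GMRES residuals: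 for the shifted system $(A-\delta I_n)\mathbf{x}=\mathbf{b}$ with starting vector $0$, $\mathbf{r}_0(\delta)=\mathbf{b}$, and for $k\ge 1$, $\mathbf{r}_k(\delta)=\mathbf{b}-\mathbf{u}_k$, where $\mathbf{u}_k$ is the minimizer of the Euclidean norm $\|\mathbf{b}-\mathbf{u}\|$ over $\mathbf{u}\in(A-\delta I_n)\,\mathrm{span}\{\mathbf{v}_1,\dots,\mathbf{v}_k\}$. The normalized residual is $\mathbf{w}_k(\delta)=\mathbf{r}_k(\delta)/\|\mathbf{r}_k(\delta)\|$ (the residual is nonzero for $0\le k\le N-1$). *)

theory Defs
  imports "Jordan_Normal_Form.Schur_Decomposition" "HOL-Analysis.L2_Norm"
begin

definition euclid_norm :: "complex vec \<Rightarrow> real" where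
  "euclid_norm v = L2_set (\<lambda>i. cmod (v $ i)) {..<dim_vec v}"

text \<open>The zero vector is mapped to itself, since \<open>1 / 0 = 0\<close>.\<close>
definition normalize_vec :: "complex vec \<Rightarrow> complex vec" where
  "normalize_vec v = complex_of_real (1 / euclid_norm v) \<cdot>\<^sub>v v"

definition vec_span :: "nat \<Rightarrow> complex vec set \<Rightarrow> complex vec set" where
  "vec_span n S = LinearCombinations.module.span class_ring (module_vec TYPE(complex) n) S"

section \<open>The Arnoldi process\<close>

text \<open>Arnoldi vectors and the scalars \<open>h\<close> are numbered from 1; the value at 0 is a dummy.
  In the library notation \<open>x \<bullet>c y\<close> is the product $y^* x$.\<close>
fun arnoldi_vec :: "complex mat \<Rightarrow> complex vec \<Rightarrow> nat \<Rightarrow> complex vec" where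
  "arnoldi_vec A b 0 = 0\<^sub>v (dim_vec b)"
| "arnoldi_vec A b (Suc k) =
    (if k = 0 then normalize_vec b
     else normalize_vec (vec (dim_vec b) (\<lambda>i.
       (A *\<^sub>v arnoldi_vec A b k) $ i
       - (\<Sum>j = 1..k. ((A *\<^sub>v arnoldi_vec A b k) \<bullet>c arnoldi_vec A b j) * arnoldi_vec A b j $ i))))"

definition arnoldi_h :: "complex mat \<Rightarrow> complex vec \<Rightarrow> nat \<Rightarrow> nat \<Rightarrow> complex" where
  "arnoldi_h A b j k = (A *\<^sub>v arnoldi_vec A b k) \<bullet>c arnoldi_vec A b j"

definition arnoldi_index :: "complex mat \<Rightarrow> complex vec \<Rightarrow> nat" where
  "arnoldi_index A b = (LEAST N. 1 \<le> N \<and> arnoldi_vec A b (N + 1) = 0\<^sub>v (dim_vec b))"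

definition hess :: "complex mat \<Rightarrow> complex vec \<Rightarrow> nat \<Rightarrow> complex mat" where
  "hess A b k = mat k k (\<lambda>(i, j). arnoldi_h A b (i + 1) (j + 1))"

definition id_under :: "nat \<Rightarrow> complex mat" where
  "id_under k = mat_of_cols (k + 1) (take k (cols (1\<^sub>m (k + 1))))"

definition hess_under :: "complex mat \<Rightarrow> complex vec \<Rightarrow> nat \<Rightarrow> complex mat" where
  "hess_under A b k = hess A b (k + 1) * id_under k"

section \<open>The QR factor\<close>

text \<open>If \<open>Q\<close> is the factor of size \<open>k\<close>, this is the adjoint of the one of size \<open>k + 1\<close>.\<close>
definition qr_step_adj :: "nat \<Rightarrow> complex mat \<Rightarrow> complex \<Rightarrow> real \<Rightarrow> complex mat" where
  "qr_step_adj k Q c s =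
     four_block_mat (1\<^sub>m (k - 1)) (0\<^sub>m (k - 1) 2) (0\<^sub>m 2 (k - 1))
       (mat_of_rows_list 2 [[cnj c, complex_of_real s], [- complex_of_real s, c]])
     * four_block_mat (mat_adjoint Q) (0\<^sub>m k 1) (0\<^sub>m 1 k) (1\<^sub>m 1)"

definition rotation_params ::
    "complex mat \<Rightarrow> complex vec \<Rightarrow> complex \<Rightarrow> nat \<Rightarrow> complex mat \<Rightarrow> complex \<Rightarrow> real \<Rightarrow> bool" where
  "rotation_params A b \<delta> k Q c s \<longleftrightarrow>
     0 \<le> s \<and> s\<^sup>2 + (cmod c)\<^sup>2 = 1 \<and>
     (\<exists>R \<in> carrier_mat k k. upper_triangular R \<and>
        (\<forall>i < k. R $$ (i, i) \<in> \<real> \<and> 0 < Re (R $$ (i, i))) \<and>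
        qr_step_adj k Q c s * (hess_under A b k - \<delta> \<cdot>\<^sub>m id_under k) = R @\<^sub>r 0\<^sub>m 1 k)"

definition the_rotation ::
    "complex mat \<Rightarrow> complex vec \<Rightarrow> complex \<Rightarrow> nat \<Rightarrow> complex mat \<Rightarrow> complex \<times> real" where
  "the_rotation A b \<delta> k Q = (THE (c, s). rotation_params A b \<delta> k Q c s)"

fun qr_Q :: "complex mat \<Rightarrow> complex vec \<Rightarrow> complex \<Rightarrow> nat \<Rightarrow> complex mat" where
  "qr_Q A b \<delta> 0 = 1\<^sub>m 0"
| "qr_Q A b \<delta> (Suc k) =
    (if k = 0 then 1\<^sub>m 1
     else let (c, s) = the_rotation A b \<delta> k (qr_Q A b \<delta> k)
          in mat_adjoint (qr_step_adj k (qr_Q A b \<delta> k) c s))"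

definition qr_c :: "complex mat \<Rightarrow> complex vec \<Rightarrow> complex \<Rightarrow> nat \<Rightarrow> complex" where
  "qr_c A b \<delta> k = fst (the_rotation A b \<delta> k (qr_Q A b \<delta> k))"

definition qr_s :: "complex mat \<Rightarrow> complex vec \<Rightarrow> complex \<Rightarrow> nat \<Rightarrow> real" where
  "qr_s A b \<delta> k = snd (the_rotation A b \<delta> k (qr_Q A b \<delta> k))"

definition qr_tau :: "complex mat \<Rightarrow> complex vec \<Rightarrow> complex \<Rightarrow> nat \<Rightarrow> complex" where
  "qr_tau A b \<delta> k =
     (mat_adjoint (qr_Q A b \<delta> k) * (hess A b k - \<delta> \<cdot>\<^sub>m 1\<^sub>m k) *\<^sub>v unit_vec k (k - 1))
       \<bullet>c unit_vec k (k - 1)"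

section \<open>GMRES arnoldi_residuals of the shifted system\<close>

definition shifted :: "complex mat \<Rightarrow> complex \<Rightarrow> complex mat" where
  "shifted A \<delta> = A - \<delta> \<cdot>\<^sub>m 1\<^sub>m (dim_row A)"

definition gmres_res :: "complex mat \<Rightarrow> complex vec \<Rightarrow> complex \<Rightarrow> nat \<Rightarrow> complex vec" where
  "gmres_res A b \<delta> k =
     (if k = 0 then b
      else b - arg_min (\<lambda>u. euclid_norm (b - u))
                 (\<lambda>u. u \<in> (*\<^sub>v) (shifted A \<delta>) ` vec_span (dim_vec b) (arnoldi_vec A b ` {1..k})))"

definition gmres_w :: "complex mat \<Rightarrow> complex vec \<Rightarrow> complex \<Rightarrow> nat \<Rightarrow> complex vec" where
  "gmres_w A b \<delta> k = normalize_vec (gmres_res A b \<delta> k)"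


section \<open>Basic facts on the Arnoldi process\<close>

text \<open>The recursion has the properties characterising the Arnoldi process: orthogonality, the
  relation \<open>A v\<^sub>k = (\<Sum>j = 1..k + 1. h\<^sub>j\<^sub>k v\<^sub>j)\<close>, and a real nonnegative subdiagonal of \<open>h\<close>. The
  last fact is what makes \<open>csqrt (h\<^sup>2 + \<bar>\<tau>\<bar>\<^sup>2)\<close> the real square root for a subdiagonal entry \<open>h\<close>.\<close>

context
  fixes A :: "complex mat" and b :: "complex vec" and n :: nat
  assumes A: "A \<in> carrier_mat n n" and b: "b \<in> carrier_vec n"
begin

lemma normalize_vec_carrier: "v \<in> carrier_vec n \<Longrightarrow> normalize_vec v \<in> carrier_vec n"
  by (simp add: normalize_vec_def)

lemma arnoldi_vec_carrier: "arnoldi_vec A b k \<in> carrier_vec n"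
proof (cases k)
  case 0
  then show ?thesis using b by simp
next
  case (Suc m)
  then show ?thesis using b by (auto intro!: normalize_vec_carrier)
qed

lemma cinner_sum: "v \<in> carrier_vec n \<Longrightarrow> w \<in> carrier_vec n \<Longrightarrow>
    v \<bullet>c w = (\<Sum>i<n. v $ i * cnj (w $ i))"
  by (simp add: scalar_prod_def lessThan_atLeast0)

lemma cinner_self: "v \<in> carrier_vec n \<Longrightarrow> v \<bullet>c v = complex_of_real ((euclid_norm v)\<^sup>2)"
  by (simp add: cinner_sum euclid_norm_def L2_set_def sum_nonneg complex_norm_square
        flip: of_real_power)

lemma euclid_norm_eq_0: "v \<in> carrier_vec n \<Longrightarrow> euclid_norm v = 0 \<longleftrightarrow> v = 0\<^sub>v n"
  by (auto simp: euclid_norm_def L2_set_def sum_nonneg_eq_0_iff sum_nonneg intro!: eq_vecI)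

definition arnoldi_resid :: "nat \<Rightarrow> complex vec" where
  "arnoldi_resid k = vec n (\<lambda>i. (A *\<^sub>v arnoldi_vec A b k) $ i
       - (\<Sum>j = 1..k. arnoldi_h A b j k * arnoldi_vec A b j $ i))"

lemma arnoldi_resid_carrier: "arnoldi_resid k \<in> carrier_vec n"
  by (simp add: arnoldi_resid_def)

lemma arnoldi_vec_Suc: "1 \<le> k \<Longrightarrow> arnoldi_vec A b (Suc k) = normalize_vec (arnoldi_resid k)"
  using b by (simp add: arnoldi_resid_def arnoldi_h_def)

lemma normalize_vec_cinner: "v \<in> carrier_vec n \<Longrightarrow> w \<in> carrier_vec n \<Longrightarrow>
    normalize_vec v \<bullet>c w = complex_of_real (1 / euclid_norm v) * (v \<bullet>c w)"
  by (simp add: normalize_vec_def)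

lemma normalize_vec_self: "v \<in> carrier_vec n \<Longrightarrow>
    normalize_vec v \<bullet>c normalize_vec v = (if v = 0\<^sub>v n then 0 else 1)"
  using euclid_norm_eq_0[of v] cinner_self[of v]
  by (auto simp: normalize_vec_def conjugate_smult_vec power2_eq_square)

lemma arnoldi_resid_cinner:
  assumes w: "w \<in> carrier_vec n"
  shows "arnoldi_resid k \<bullet>c w = (A *\<^sub>v arnoldi_vec A b k) \<bullet>c w
      - (\<Sum>j = 1..k. arnoldi_h A b j k * (arnoldi_vec A b j \<bullet>c w))"
proof -
  have Av: "A *\<^sub>v arnoldi_vec A b k \<in> carrier_vec n"
    using A arnoldi_vec_carrier by simp
  have "(\<Sum>i<n. (\<Sum>j = 1..k. arnoldi_h A b j k * arnoldi_vec A b j $ i) * cnj (w $ i))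
      = (\<Sum>j = 1..k. arnoldi_h A b j k * (\<Sum>i<n. arnoldi_vec A b j $ i * cnj (w $ i)))"
    by (simp only: sum_distrib_left sum_distrib_right sum.swap[of _ "{..<n}"] mult.assoc)
  then show ?thesis
    unfolding cinner_sum[OF arnoldi_resid_carrier w] cinner_sum[OF Av w]
      cinner_sum[OF arnoldi_vec_carrier w]
    by (simp add: arnoldi_resid_def algebra_simps sum_subtractf)
qed

lemma arnoldi_vec_self:
  assumes "1 \<le> k"
  shows "arnoldi_vec A b k \<bullet>c arnoldi_vec A b k = (if arnoldi_vec A b k = 0\<^sub>v n then 0 else 1)"
proof -
  obtain v where v: "v \<in> carrier_vec n" "arnoldi_vec A b k = normalize_vec v"
    using assms b arnoldi_resid_carrier arnoldi_vec_Suc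
    by (cases k; cases "k = 1") auto
  show ?thesis
    using normalize_vec_self[OF v(1)] v normalize_vec_carrier[OF v(1)]
    by (cases "v = 0\<^sub>v n") (auto simp: normalize_vec_def)
qed

lemma cinner_commute: "v \<in> carrier_vec n \<Longrightarrow> w \<in> carrier_vec n \<Longrightarrow> v \<bullet>c w = cnj (w \<bullet>c v)"
  by (simp add: cinner_sum mult.commute)

lemma arnoldi_vec_orthogonal:
  "1 \<le> i \<Longrightarrow> i < j \<Longrightarrow> arnoldi_vec A b j \<bullet>c arnoldi_vec A b i = 0"
  and arnoldi_resid_cinner_0: "1 \<le> k \<Longrightarrow> 1 \<le> i \<Longrightarrow> i \<le> k \<Longrightarrow> arnoldi_resid k \<bullet>c arnoldi_vec A b i = 0"
proof -
  have step: "arnoldi_resid k \<bullet>c arnoldi_vec A b i = 0"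
    if orth: "\<And>p q. 1 \<le> p \<Longrightarrow> p < q \<Longrightarrow> q \<le> k \<Longrightarrow> arnoldi_vec A b q \<bullet>c arnoldi_vec A b p = 0"
      and i: "1 \<le> i" "i \<le> k" for i k
  proof -
    have "arnoldi_h A b p k * (arnoldi_vec A b p \<bullet>c arnoldi_vec A b i)
        = (if p = i then arnoldi_h A b i k else 0)" if "p \<in> {1..k}" for p
    proof -
      consider "p < i" | "i < p" | "p = i" by linarith
      then show ?thesis
      proof cases
        case 1
        then have "arnoldi_vec A b i \<bullet>c arnoldi_vec A b p = 0" using orth that i by simp
        then show ?thesis
          using 1 cinner_commute[OF arnoldi_vec_carrier[of p] arnoldi_vec_carrier[of i]] by simp
      next
        case 2
        then show ?thesis using orth that i by simp
      next
        case 3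
        have "arnoldi_h A b i k = 0" if "arnoldi_vec A b i = 0\<^sub>v n"
          using that A arnoldi_vec_carrier[of k] by (simp add: arnoldi_h_def)
        then show ?thesis using 3 arnoldi_vec_self[OF i(1)] by auto
      qed
    qed
    then have "(\<Sum>p = 1..k. arnoldi_h A b p k * (arnoldi_vec A b p \<bullet>c arnoldi_vec A b i))
        = arnoldi_h A b i k"
      using i by simp
    then show ?thesis
      by (simp add: arnoldi_resid_cinner[OF arnoldi_vec_carrier] arnoldi_h_def)
  qed
  have orth: "\<forall>i j. 1 \<le> i \<longrightarrow> i < j \<longrightarrow> j \<le> k \<longrightarrow> arnoldi_vec A b j \<bullet>c arnoldi_vec A b i = 0" for k
  proof (induction k)
    case 0
    then show ?case by simp
  next
    case (Suc k)
    have "arnoldi_vec A b (Suc k) \<bullet>c arnoldi_vec A b i = 0" if "1 \<le> i" "i < Suc k" for i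
    proof -
      have "arnoldi_resid k \<bullet>c arnoldi_vec A b i = 0"
        using Suc that by (intro step) auto
      then show ?thesis
        using that normalize_vec_cinner[OF arnoldi_resid_carrier arnoldi_vec_carrier]
        by (subst arnoldi_vec_Suc) auto
    qed
    then show ?case using Suc by (metis le_Suc_eq)
  qed
  show "1 \<le> i \<Longrightarrow> i < j \<Longrightarrow> arnoldi_vec A b j \<bullet>c arnoldi_vec A b i = 0"
    using orth[of j] by simp
  show "1 \<le> k \<Longrightarrow> 1 \<le> i \<Longrightarrow> i \<le> k \<Longrightarrow> arnoldi_resid k \<bullet>c arnoldi_vec A b i = 0"
    using orth[of k] by (intro step) auto
qed

theorem arnoldi_h_subdiag:
  assumes k: "1 \<le> k"
  shows "arnoldi_h A b (Suc k) k = complex_of_real (euclid_norm (arnoldi_resid k))"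
proof -
  let ?v = "arnoldi_vec A b (Suc k)"
  have v: "?v \<in> carrier_vec n" by (rule arnoldi_vec_carrier)
  have v_def: "?v = normalize_vec (arnoldi_resid k)" by (rule arnoldi_vec_Suc[OF k])
  have z: "arnoldi_vec A b j \<bullet>c ?v = 0" if "j \<in> {1..k}" for j
    using arnoldi_vec_orthogonal[of j "Suc k"] that
      cinner_commute[OF arnoldi_vec_carrier v, of j] by (simp del: arnoldi_vec.simps)
  have "arnoldi_h A b (Suc k) k = arnoldi_resid k \<bullet>c ?v"
    using z by (simp add: arnoldi_resid_cinner[OF v] arnoldi_h_def del: arnoldi_vec.simps)
  also have "\<dots> = cnj (?v \<bullet>c arnoldi_resid k)"
    by (rule cinner_commute[OF arnoldi_resid_carrier v])
  also have "\<dots> = complex_of_real (euclid_norm (arnoldi_resid k))"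
    unfolding v_def normalize_vec_cinner[OF arnoldi_resid_carrier arnoldi_resid_carrier]
      cinner_self[OF arnoldi_resid_carrier]
    by (simp add: power2_eq_square)
  finally show ?thesis .
qed

lemma arnoldi_relation:
  assumes k: "1 \<le> k" and i: "i < n"
  shows "(A *\<^sub>v arnoldi_vec A b k) $ i = (\<Sum>j = 1..Suc k. arnoldi_h A b j k * arnoldi_vec A b j $ i)"
proof -
  have "arnoldi_resid k $ i = arnoldi_h A b (Suc k) k * arnoldi_vec A b (Suc k) $ i"
  proof (cases "arnoldi_resid k = 0\<^sub>v n")
    case True
    then show ?thesis
      using i euclid_norm_eq_0[OF arnoldi_resid_carrier, of k] by (simp add: arnoldi_h_subdiag[OF k] del: arnoldi_vec.simps)
  next
    case False
    then show ?thesis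
      using i euclid_norm_eq_0[OF arnoldi_resid_carrier, of k] arnoldi_resid_carrier[of k] arnoldi_vec_Suc[OF k]
      by (simp add: arnoldi_h_subdiag[OF k] normalize_vec_def del: arnoldi_vec.simps)
  qed
  then show ?thesis using i by (simp add: arnoldi_resid_def diff_eq_eq add.commute del: arnoldi_vec.simps)
qed

end

end

theory Submission
  imports Defs
begin

text \<open>
  Let \<open>dir k\<close> be the vector $d_k = V_k Q_k e_k$, where $V_k$ has the columns
  $v_1, \ldots, v_k$. Since $Q_k^* (\underline{H}_{k-1} - \delta \underline{I}_{k-1})$ has zero last
  row, $d_k$ is a unit vector orthogonal to $(A - \delta I)\, \mathrm{span}(v_1, \ldots, v_{k-1})$, and
  this space together with $d_k$ contains $\mathrm{span}(v_1, \ldots, v_k)$, in particular $b$. So the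
  residual is $(d_k^* b)\, d_k$. The recursion
  $d_{k+1} = - s_k d_k + \overline{c_k} v_{k+1}$ shows that $d_k^* b$ has the sign $(-1)^{k-1}$, whence
  $w_{k-1} = (-1)^{k-1} d_k$, while $d_k^* (A - \delta I) v_k = \tau_k$ by definition of $d_k$. The
  formulas for $s_k$ and $c_k$ express that the rotation maps $(\tau_k, h_{k+1,k})$ to
  $(\varrho, 0)$ with $\varrho > 0$.
\<close>

declare arnoldi_vec.simps(2) [simp del] qr_Q.simps(2) [simp del]

section \<open>Entries of the matrices in the QR recursion\<close>

lemma mat_adjoint_index:
  "i < dim_col B \<Longrightarrow> j < dim_row B \<Longrightarrow> mat_adjoint B $$ (i, j) = cnj (B $$ (j, i))"
  by (simp add: mat_adjoint_def mat_of_rows_def)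

lemma mat_adjoint_carrier: "B \<in> carrier_mat p q \<Longrightarrow> mat_adjoint B \<in> carrier_mat q p"
  by (auto simp: mat_adjoint_def mat_of_rows_def)

lemma qr_step_adj_carrier:
  assumes "Q \<in> carrier_mat k k" "1 \<le> k"
  shows "qr_step_adj k Q c s \<in> carrier_mat (k + 1) (k + 1)"
  using assms mat_adjoint_carrier[OF assms(1)]
  by (auto simp: qr_step_adj_def mat_of_rows_list_def intro!: carrier_matI)

text \<open>The left block factor is the identity outside its last two rows, so only the last row of
  \<open>mat_adjoint Q\<close> and the appended unit row are mixed. Matrix indices start at 0, hence
  the rotation acts on rows \<open>k - 1\<close> and \<open>k\<close>.\<close>

lemma qr_step_adj_index:
  assumes Q: "Q \<in> carrier_mat k k" and k: "1 \<le> k" and i: "i \<le> k" and j: "j \<le> k"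
  shows "qr_step_adj k Q c s $$ (i, j) =
    (if i = k then (if j = k then c else - complex_of_real s * cnj (Q $$ (j, k - 1)))
     else if i = k - 1 then (if j = k then complex_of_real s else cnj c * cnj (Q $$ (j, k - 1)))
     else if j = k then 0 else cnj (Q $$ (j, i)))"
proof -
  define G where "G = mat_of_rows_list 2 [[cnj c, complex_of_real s], [- complex_of_real s, c]]"
  define X where
    "X = four_block_mat (1\<^sub>m (k - 1)) (0\<^sub>m (k - 1) 2) (0\<^sub>m 2 (k - 1)) G"
  define Y where "Y = four_block_mat (mat_adjoint Q) (0\<^sub>m k 1) (0\<^sub>m 1 k) (1\<^sub>m 1)"
  have G: "G \<in> carrier_mat 2 2" by (auto simp: G_def mat_of_rows_list_def intro!: carrier_matI)
  have aQ: "mat_adjoint Q \<in> carrier_mat k k" using mat_adjoint_carrier[OF Q] .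
  have X: "X $$ (i, l) =
    (if i < k - 1 then (if l = i then 1 else 0) else if l < k - 1 then 0
     else if i = k - 1 then (if l = k - 1 then cnj c else s)
     else if l = k - 1 then - s else c)" if "l \<le> k" for l
    unfolding X_def using that i k G
    by (subst index_mat_four_block)
      (auto simp: G_def mat_of_rows_list_def not_less nth_Cons split: nat.splits)
  have Y: "Y $$ (l, j) = (if l < k then (if j < k then cnj (Q $$ (j, l)) else 0)
      else if j < k then 0 else 1)" if "l \<le> k" for l
    unfolding Y_def using that j k aQ Q by (subst index_mat_four_block) (auto simp: mat_adjoint_index)
  have dim: "X \<in> carrier_mat (k + 1) (k + 1)" "Y \<in> carrier_mat (k + 1) (k + 1)"
    using G aQ k by (auto simp: X_def Y_def intro!: carrier_matI)
  have "qr_step_adj k Q c s $$ (i, j) = (X * Y) $$ (i, j)"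
    by (simp add: qr_step_adj_def X_def Y_def G_def)
  \<comment> \<open>The two columns touched by the rotation are split off; on the remaining ones
    \<open>X\<close> is the identity.\<close>
  also have "\<dots> = (\<Sum>l\<in>insert k (insert (k - 1) {..<k - 1}). X $$ (i, l) * Y $$ (l, j))"
  proof -
    have "insert k (insert (k - 1) {..<k - 1}) = {0..<k + 1}" using k by auto
    then show ?thesis using dim i j by (simp add: scalar_prod_def del: sum.op_ivl_Suc)
  qed
  also have "\<dots> = X $$ (i, k) * Y $$ (k, j) + (X $$ (i, k - 1) * Y $$ (k - 1, j)
      + (\<Sum>l<k - 1. X $$ (i, l) * Y $$ (l, j)))"
    using k by (cases k) auto
  also have "(\<Sum>l<k - 1. X $$ (i, l) * Y $$ (l, j)) = (\<Sum>l<k - 1. if l = i then Y $$ (i, j) else 0)"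
    by (rule sum.cong) (auto simp: X)
  also have "\<dots> = (if i < k - 1 then Y $$ (i, j) else 0)" by simp
  finally show ?thesis
    using i j k X[of k] X[of "k - 1"] Y[of k] Y[of "k - 1"] Y[of i] by auto
qed

lemma id_under_carrier: "id_under k \<in> carrier_mat (k + 1) k"
  by (auto simp: id_under_def intro!: carrier_matI)

lemma id_under_index:
  "i \<le> k \<Longrightarrow> j < k \<Longrightarrow> id_under k $$ (i, j) = (if i = j then 1 else 0)"
  by (simp add: id_under_def mat_of_cols_def)

text \<open>Indices start at 0 as for matrices, whereas those of \<open>arnoldi_h\<close> start at
  1. There is no size parameter, so the square and the rectangular shifted matrices of all sizes
  share these entries.\<close>

definition shifted_entry :: "complex mat \<Rightarrow> complex vec \<Rightarrow> complex \<Rightarrow> nat \<Rightarrow> nat \<Rightarrow> complex" where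
  "shifted_entry A b \<delta> i j = arnoldi_h A b (i + 1) (j + 1) - (if i = j then \<delta> else 0)"

lemma hess_under_shifted:
  "hess_under A b k - \<delta> \<cdot>\<^sub>m id_under k = mat (k + 1) k (\<lambda>(i, j). shifted_entry A b \<delta> i j)"
proof (rule eq_matI)
  fix i j assume ij: "i < dim_row (mat (k + 1) k (\<lambda>(i, j). shifted_entry A b \<delta> i j))"
    "j < dim_col (mat (k + 1) k (\<lambda>(i, j). shifted_entry A b \<delta> i j))"
  have "hess_under A b k $$ (i, j)
      = (\<Sum>l = 0..<Suc k. arnoldi_h A b (Suc i) (Suc l) * (if l = j then 1 else 0))"
    using ij id_under_carrier[of k]
    by (auto simp: hess_under_def hess_def scalar_prod_def id_under_index simp del: sum.op_ivl_Suc)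
  also have "\<dots> = arnoldi_h A b (i + 1) (j + 1)" using ij by (simp add: if_distrib sum.delta cong: if_cong del: sum.op_ivl_Suc)
  finally show "(hess_under A b k - \<delta> \<cdot>\<^sub>m id_under k) $$ (i, j) =
      mat (k + 1) k (\<lambda>(i, j). shifted_entry A b \<delta> i j) $$ (i, j)"
    using ij id_under_carrier[of k] by (auto simp: shifted_entry_def id_under_index)
qed (use id_under_carrier[of k] in \<open>auto simp: hess_under_def hess_def\<close>)

lemma hess_shifted:
  "hess A b k - \<delta> \<cdot>\<^sub>m 1\<^sub>m k = mat k k (\<lambda>(i, j). shifted_entry A b \<delta> i j)"
  by (rule eq_matI) (auto simp: hess_def shifted_entry_def)

section \<open>Best approximation and rotation parameters\<close>

lemma euclid_norm_smult: "euclid_norm (a \<cdot>\<^sub>v v) = cmod a * euclid_norm v"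
  by (simp add: euclid_norm_def L2_set_def norm_mult power_mult_distrib real_sqrt_mult
      flip: sum_distrib_left)

lemma euclid_norm_nonneg: "0 \<le> euclid_norm v"
  by (simp add: euclid_norm_def)

text \<open>By Pythagoras, \<open>b - x\<close> exceeds \<open>b - u\<close> in squared norm by that
  of \<open>u - x\<close>. So \<open>u\<close> is the only minimizer, and uniqueness is what
  determines the choice made by \<open>arg_min\<close>.\<close>

lemma arg_min_orthogonal:
  assumes b: "b \<in> carrier_vec n" and S: "S \<subseteq> carrier_vec n" and u: "u \<in> S"
    and orth: "\<And>x. x \<in> S \<Longrightarrow> (u - x) \<bullet>c (b - u) = 0"
  shows "arg_min (\<lambda>x. euclid_norm (b - x)) (\<lambda>x. x \<in> S) = u"
proof -
  have pyth: "(euclid_norm (b - x))\<^sup>2 = (euclid_norm (b - u))\<^sup>2 + (euclid_norm (u - x))\<^sup>2"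
    if x: "x \<in> S" for x
  proof -
    have c: "b - x \<in> carrier_vec n" "b - u \<in> carrier_vec n" "u - x \<in> carrier_vec n"
      "u \<in> carrier_vec n" "x \<in> carrier_vec n"
      using b S u x by (auto intro!: minus_carrier_vec)
    have eq: "b - x = (b - u) + (u - x)" using c b by auto
    have o2: "(b - u) \<bullet>c (u - x) = 0"
      using orth[OF x] cinner_commute[of A n b, OF _ b c(2,3)] 
      by (metis cinner_commute[OF zero_carrier_mat b c(2,3)] complex_cnj_zero)
    have "(b - x) \<bullet>c (b - x) = (b - u) \<bullet>c (b - u) + (u - x) \<bullet>c (u - x)"
      unfolding eq using c orth[OF x] o2
      by (simp add: conjugate_add_vec add_scalar_prod_distrib[of _ n] scalar_prod_add_distrib[of _ n])
    then show ?thesis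
      unfolding cinner_self[OF zero_carrier_mat b c(1)] cinner_self[OF zero_carrier_mat b c(2)]
        cinner_self[OF zero_carrier_mat b c(3)]
      by (metis of_real_add of_real_eq_iff)
  qed
  have le: "euclid_norm (b - u) \<le> euclid_norm (b - x)" if "x \<in> S" for x
    by (rule power2_le_imp_le[OF _ euclid_norm_nonneg]) (simp add: pyth[OF that])
  let ?P = "is_arg_min (\<lambda>x. euclid_norm (b - x)) (\<lambda>x. x \<in> S)"
  have "?P u" using u le by (auto simp: is_arg_min_linorder)
  then have m: "?P (arg_min (\<lambda>x. euclid_norm (b - x)) (\<lambda>x. x \<in> S))"
    unfolding arg_min_def by (rule someI)
  define x where "x = arg_min (\<lambda>x. euclid_norm (b - x)) (\<lambda>x. x \<in> S)"
  have x: "x \<in> S" "euclid_norm (b - x) \<le> euclid_norm (b - u)"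
    using m u unfolding x_def[symmetric] by (auto simp: is_arg_min_linorder)
  then have "euclid_norm (b - x) = euclid_norm (b - u)" using le by (simp add: antisym)
  then have "euclid_norm (u - x) = 0" using pyth[OF x(1)] by simp
  moreover have "u \<in> carrier_vec n" "x \<in> carrier_vec n" using S u x by auto
  ultimately have "u - x = 0\<^sub>v n" using euclid_norm_eq_0[OF zero_carrier_mat b, of "u - x"] by auto
  then have "u = x"
    using \<open>u \<in> carrier_vec n\<close> \<open>x \<in> carrier_vec n\<close> by (auto simp: vec_eq_iff)
  then show ?thesis by (simp add: x_def)
qed

text \<open>The linear equation gives \<open>c\<close> as a multiple of \<open>s\<close>; the
  normalization then fixes the square of \<open>s\<close>, and \<open>0 \<le> s\<close> selects the
  root.\<close>

lemma rotation_unique: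
  fixes \<tau> c :: complex and s \<eta> :: real
  assumes h: "0 < \<eta>"
  shows "0 \<le> s \<and> s\<^sup>2 + (cmod c)\<^sup>2 = 1 \<and> - complex_of_real s * \<tau> + c * \<eta> = 0 \<longleftrightarrow>
    c = \<tau> / complex_of_real (sqrt (\<eta>\<^sup>2 + (cmod \<tau>)\<^sup>2)) \<and> s = \<eta> / sqrt (\<eta>\<^sup>2 + (cmod \<tau>)\<^sup>2)"
    (is "?L \<longleftrightarrow> ?R")
proof -
  define \<rho> where "\<rho> = sqrt (\<eta>\<^sup>2 + (cmod \<tau>)\<^sup>2)"
  have \<rho>: "0 < \<rho>" "\<rho>\<^sup>2 = \<eta>\<^sup>2 + (cmod \<tau>)\<^sup>2"
    using h by (auto simp: \<rho>_def intro!: add_pos_nonneg)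
  show ?thesis unfolding \<rho>_def[symmetric]
  proof
    assume L: ?L
    then have c: "c = complex_of_real s * \<tau> / \<eta>" using h by (simp add: field_simps)
    then have "(cmod c)\<^sup>2 = s\<^sup>2 * (cmod \<tau>)\<^sup>2 / \<eta>\<^sup>2"
      by (simp add: norm_mult norm_divide power_mult_distrib power_divide)
    then have "\<eta>\<^sup>2 * (s\<^sup>2 + s\<^sup>2 * (cmod \<tau>)\<^sup>2 / \<eta>\<^sup>2) = \<eta>\<^sup>2" using L by simp
    then have "s\<^sup>2 * \<rho>\<^sup>2 = \<eta>\<^sup>2" using h unfolding \<rho>(2) distrib_left by (simp add: mult.commute)
    then have "(s * \<rho>)\<^sup>2 = \<eta>\<^sup>2" by (simp add: power_mult_distrib)
    then have "s * \<rho> = \<eta>" using L h \<rho> by (simp add: power2_eq_iff_nonneg)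
    then have s: "s = \<eta> / \<rho>" using \<rho> by (simp add: field_simps)
    then show "c = \<tau> / \<rho> \<and> s = \<eta> / \<rho>" using c h by simp
  next
    assume R: "c = \<tau> / \<rho> \<and> s = \<eta> / \<rho>"
    then have "s\<^sup>2 + (cmod c)\<^sup>2 = (\<eta>\<^sup>2 + (cmod \<tau>)\<^sup>2) / \<rho>\<^sup>2"
      by (simp add: norm_divide power_divide add_divide_distrib)
    then have "s\<^sup>2 + (cmod c)\<^sup>2 = 1" using \<rho> h by simp
    then show ?L using R h \<rho> by simp
  qed
qed

section \<open>The Arnoldi basis and the shifted operator\<close>

locale shifted_arnoldi =
  fixes A :: "complex mat" and b :: "complex vec" and \<delta> :: complex and n :: nat
  assumes A: "A \<in> carrier_mat n n" and b: "b \<in> carrier_vec n" and b_nz: "b \<noteq> 0\<^sub>v n"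
begin

abbreviation "N \<equiv> arnoldi_index A b"
abbreviation "v \<equiv> arnoldi_vec A b"
abbreviation "h \<equiv> arnoldi_h A b"
abbreviation "M \<equiv> shifted A \<delta>"
abbreviation "E \<equiv> shifted_entry A b \<delta>"

lemma M_carrier: "M \<in> carrier_mat n n"
  using A unfolding shifted_def by (intro minus_carrier_mat) auto

lemma dim_M [simp]: "dim_row M = n" "dim_col M = n"
  using M_carrier by auto

lemma v_carrier [simp]: "v k \<in> carrier_vec n"
  by (rule arnoldi_vec_carrier[OF A b])

lemma dim_v [simp]: "dim_vec (v k) = n"
  using v_carrier carrier_vecD by blast

lemma Av_carrier [simp]: "A *\<^sub>v v k \<in> carrier_vec n"
  using A by simp

lemma Mv_carrier [simp]: "M *\<^sub>v v k \<in> carrier_vec n"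
  using M_carrier by simp

lemmas cinner_cnj = cinner_commute[OF A b]

lemma v_1: "v 1 = complex_of_real (1 / euclid_norm b) \<cdot>\<^sub>v b"
  by (simp add: arnoldi_vec.simps(2) normalize_vec_def)

lemma b_v_1: "b = complex_of_real (euclid_norm b) \<cdot>\<^sub>v v 1"
  using b b_nz euclid_norm_eq_0[OF A b b] by (simp add: v_1[simplified] smult_smult_assoc)

lemma v_nonzero:
  assumes "1 \<le> j" "j \<le> N"
  shows "v j \<noteq> 0\<^sub>v n"
proof (cases "j = 1")
  case True
  show ?thesis
  proof
    assume "v j = 0\<^sub>v n"
    then have "b = complex_of_real (euclid_norm b) \<cdot>\<^sub>v 0\<^sub>v n" using b_v_1 True by simp
    also have "\<dots> = 0\<^sub>v n" by auto
    finally show False using b_nz by simp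
  qed
next
  case False
  \<comment> \<open>Minimality of \<open>N\<close> is applied to the index \<open>j - 1\<close>. It
    must be at least 1, which is why \<open>j = 1\<close> is settled by \<open>b_nz\<close>
    instead.\<close>
  then have "\<not> (1 \<le> j - 1 \<and> v (j - 1 + 1) = 0\<^sub>v (dim_vec b))"
    using assms by (intro not_less_Least) (simp add: arnoldi_index_def)
  then show ?thesis using False assms b by simp
qed

lemma v_orthogonal: "1 \<le> i \<Longrightarrow> 1 \<le> j \<Longrightarrow> i \<noteq> j \<Longrightarrow> v i \<bullet>c v j = 0"
  using arnoldi_vec_orthogonal[OF A b, of i j] arnoldi_vec_orthogonal[OF A b, of j i]
    cinner_cnj[of "v i" "v j"] by (cases "i < j") auto

lemma v_orthonormal:
  "1 \<le> i \<Longrightarrow> 1 \<le> j \<Longrightarrow> j \<le> N \<Longrightarrow> v i \<bullet>c v j = (if i = j then 1 else 0)"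
  using v_orthogonal[of i j] arnoldi_vec_self[OF A b, of j] v_nonzero[of j] by auto

text \<open>The product of the matrix with columns \<open>v 1, ..., v k\<close> and a coefficient
  vector. Coefficients form a function on the naturals, so that one \<open>y\<close> serves
  combinations of every length.\<close>

definition comb :: "nat \<Rightarrow> (nat \<Rightarrow> complex) \<Rightarrow> complex vec" where
  "comb k y = vec n (\<lambda>i. \<Sum>j = 1..k. y j * v j $ i)"

lemma comb_carrier [simp]: "comb k y \<in> carrier_vec n"
  by (simp add: comb_def)

lemma dim_comb [simp]: "dim_vec (comb k y) = n"
  by (simp add: comb_def)

lemma comb_0 [simp]: "comb 0 y = 0\<^sub>v n"
  by (auto simp: comb_def)

lemma comb_Suc: "comb (Suc k) y = comb k y + y (Suc k) \<cdot>\<^sub>v v (Suc k)"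
  by (auto simp: comb_def)

lemma comb_cong: "(\<And>j. 1 \<le> j \<Longrightarrow> j \<le> k \<Longrightarrow> y j = z j) \<Longrightarrow> comb k y = comb k z"
  by (auto simp: comb_def intro!: eq_vecI sum.cong)

lemma comb_add: "comb k y + comb k z = comb k (\<lambda>j. y j + z j)"
  by (auto simp: comb_def sum.distrib algebra_simps)

lemma comb_smult: "a \<cdot>\<^sub>v comb k y = comb k (\<lambda>j. a * y j)"
  by (auto simp: comb_def sum_distrib_left algebra_simps)

lemma comb_cinner:
  assumes w: "w \<in> carrier_vec n"
  shows "comb k y \<bullet>c w = (\<Sum>j = 1..k. y j * (v j \<bullet>c w))"
  by (induction k)
    (use w in \<open>auto simp: comb_Suc add_scalar_prod_distrib[of _ n]\<close>)

lemma cinner_comb: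
  assumes w: "w \<in> carrier_vec n"
  shows "w \<bullet>c comb k y = (\<Sum>j = 1..k. cnj (y j) * (w \<bullet>c v j))"
  unfolding cinner_cnj[OF w comb_carrier] comb_cinner[OF w] cnj_sum complex_cnj_mult
  by (intro sum.cong) (auto simp: cinner_cnj[OF w v_carrier])

lemma Av_comb: "1 \<le> k \<Longrightarrow> A *\<^sub>v v k = comb (Suc k) (\<lambda>j. h j k)"
  by (rule eq_vecI)
    (use A in \<open>auto simp: comb_def arnoldi_relation[OF A b] simp del: index_mult_mat_vec sum.cl_ivl_Suc\<close>)

lemma Mv: "M *\<^sub>v v k = A *\<^sub>v v k - \<delta> \<cdot>\<^sub>v v k"
proof -
  have "(\<delta> \<cdot>\<^sub>m 1\<^sub>m n) *\<^sub>v v k = \<delta> \<cdot>\<^sub>v v k"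
    by (rule eq_vecI) (auto simp: scalar_prod_def mult.assoc if_distrib if_distribR sum.delta cong: if_cong)
  then show ?thesis
    using A minus_mult_distrib_mat_vec[OF A, of "\<delta> \<cdot>\<^sub>m 1\<^sub>m n" "v k"] by (simp add: shifted_def)
qed

lemma Mv_cinner_v:
  assumes "1 \<le> i" "1 \<le> j" "j \<le> N"
  shows "(M *\<^sub>v v j) \<bullet>c v i = E (i - 1) (j - 1)"
  using assms v_orthonormal[of j j] v_orthogonal[of j i]
  by (cases "i = j") (auto simp: Mv minus_scalar_prod_distrib[of _ n] shifted_entry_def arnoldi_h_def)

text \<open>The Hessenberg shape: \<open>A *\<^sub>v v j\<close> is a combination of
  \<open>v 1, ..., v (j + 1)\<close>, all of which are orthogonal to \<open>v i\<close>.\<close>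

lemma h_zero:
  assumes "1 \<le> j" "j + 1 < i"
  shows "h i j = 0"
proof -
  have "h i j = comb (Suc j) (\<lambda>i. h i j) \<bullet>c v i"
    using Av_comb[OF assms(1)] by (simp add: arnoldi_h_def[of _ _ i])
  also have "\<dots> = 0"
    unfolding comb_cinner[OF v_carrier]
    by (rule sum.neutral) (use assms in \<open>auto intro!: v_orthogonal\<close>)
  finally show ?thesis .
qed

lemma E_zero: "j + 1 < i \<Longrightarrow> E i j = 0"
  by (simp add: shifted_entry_def h_zero)

text \<open>A real version of the subdiagonal entry, for use in inequalities and real square roots;
  by \<open>h_subdiag\<close> the real part loses nothing.\<close>

definition hs :: "nat \<Rightarrow> real" where
  "hs k = Re (h (Suc k) k)"

lemma h_subdiag: "1 \<le> k \<Longrightarrow> h (Suc k) k = complex_of_real (hs k)"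
  by (simp add: hs_def arnoldi_h_subdiag[OF A b])

text \<open>If the unnormalized next vector were zero, then so would be \<open>v (k + 1)\<close>,
  contradicting \<open>k < N\<close>.\<close>

lemma hs_pos:
  assumes "1 \<le> k" "k < N"
  shows "0 < hs k"
proof -
  have "arnoldi_resid A b n k \<noteq> 0\<^sub>v n"
    using v_nonzero[of "Suc k"] assms arnoldi_vec_Suc[OF A b, of k] by (auto simp: normalize_vec_def)
  then have "euclid_norm (arnoldi_resid A b n k) \<noteq> 0"
    using euclid_norm_eq_0[OF A b arnoldi_resid_carrier[OF A b]] by simp
  then show ?thesis
    using assms euclid_norm_nonneg[of "arnoldi_resid A b n k"]
    by (simp add: hs_def arnoldi_h_subdiag[OF A b])
qed

lemma E_subdiag: "1 \<le> k \<Longrightarrow> E k (k - Suc 0) = complex_of_real (hs k)"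
  using h_subdiag[of k] by (simp add: shifted_entry_def)

section \<open>The reduction invariant and the choice of the rotation\<close>

text \<open>The entries of $Q^* (H_k - \delta I_k)$, with indices starting at 0.\<close>
definition red :: "nat \<Rightarrow> complex mat \<Rightarrow> nat \<Rightarrow> nat \<Rightarrow> complex" where
  "red k Q i j = (\<Sum>l<k. cnj (Q $$ (l, i)) * E l j)"

lemma step_mult_index:
  assumes Q: "Q \<in> carrier_mat k k" and k: "1 \<le> k" and i: "i \<le> k"
  shows "(\<Sum>l<k + 1. qr_step_adj k Q c s $$ (i, l) * E l j) =
    (if i = k then - complex_of_real s * red k Q (k - 1) j + c * E k j
     else if i = k - 1 then cnj c * red k Q (k - 1) j + complex_of_real s * E k j
     else red k Q i j)"
  using i by (auto simp: qr_step_adj_index[OF Q k] red_def sum_distrib_left algebra_simps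
      sum_negf intro!: sum.cong)

text \<open>The invariant of the recursion: the first \<open>k - 1\<close> columns are upper
  triangular with positive diagonal. The last column is unconstrained; its bottom entry will be the
  number \<tau>.\<close>

definition reduced :: "nat \<Rightarrow> complex mat \<Rightarrow> bool" where
  "reduced k Q \<longleftrightarrow> Q \<in> carrier_mat k k \<and>
     (\<forall>j<k - 1. (\<forall>i<k. j < i \<longrightarrow> red k Q i j = 0) \<and> red k Q j j \<in> \<real> \<and> 0 < Re (red k Q j j))"

text \<open>The earlier columns are triangular already, so the existence of \<open>R\<close> comes
  down to annihilating the entry below the last diagonal position. Positivity of the new diagonal
  entry follows, because it is the norm of the rotated pair.\<close>

lemma rotation_params_iff:
  assumes Q: "reduced k Q" and k: "1 \<le> k" "k < N"
  shows "rotation_params A b \<delta> k Q c s \<longleftrightarrow>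
    0 \<le> s \<and> s\<^sup>2 + (cmod c)\<^sup>2 = 1 \<and> - complex_of_real s * red k Q (k - 1) (k - 1) + c * hs k = 0"
    (is "?L \<longleftrightarrow> ?R")
proof -
  have Qc: "Q \<in> carrier_mat k k" using Q by (simp add: reduced_def)
  define P where "P = qr_step_adj k Q c s * (hess_under A b k - \<delta> \<cdot>\<^sub>m id_under k)"
  have S: "qr_step_adj k Q c s \<in> carrier_mat (k + 1) (k + 1)" by (rule qr_step_adj_carrier[OF Qc k(1)])
  have P: "P \<in> carrier_mat (k + 1) k" using S by (simp add: P_def hess_under_shifted)
  have P_index: "P $$ (i, j) =
    (if i = k then - complex_of_real s * red k Q (k - 1) j + c * E k j
     else if i = k - 1 then cnj c * red k Q (k - 1) j + complex_of_real s * E k j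
     else red k Q i j)" if "i \<le> k" "j < k" for i j
  proof -
    have "P $$ (i, j) = (\<Sum>l<k + 1. qr_step_adj k Q c s $$ (i, l) * E l j)"
      using that S by (simp add: P_def hess_under_shifted scalar_prod_def lessThan_atLeast0 del: sum.op_ivl_Suc)
    then show ?thesis using step_mult_index[OF Qc k(1) that(1)] by simp
  qed
  show ?thesis
  proof
    assume L: ?L
    then obtain R where R: "R \<in> carrier_mat k k" "P = R @\<^sub>r 0\<^sub>m 1 k"
      unfolding rotation_params_def P_def[symmetric] by blast
    have "P $$ (k, k - 1) = 0" unfolding R(2) using R(1) k by (simp add: append_rows_def)
    then show ?R using L P_index[of k "k - 1"] k E_subdiag by (simp add: rotation_params_def)
  next
    assume r: ?R
    let ?\<tau> = "red k Q (k - 1) (k - 1)"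
    define \<rho> where "\<rho> = sqrt ((hs k)\<^sup>2 + (cmod ?\<tau>)\<^sup>2)"
    define R where "R = mat k k (\<lambda>(i, j). P $$ (i, j))"
    have cs: "c = ?\<tau> / complex_of_real \<rho>" "s = hs k / \<rho>"
      using r rotation_unique[OF hs_pos[OF k], of s c ?\<tau>] by (auto simp: \<rho>_def)
    have \<rho>: "0 < \<rho>" "\<rho>\<^sup>2 = (hs k)\<^sup>2 + (cmod ?\<tau>)\<^sup>2"
      using hs_pos[OF k] by (auto simp: \<rho>_def intro!: add_pos_nonneg)
    \<comment> \<open>The new diagonal entry, computed from the explicit values of \<open>c\<close>
      and \<open>s\<close>.\<close>
    have "cnj c * ?\<tau> + complex_of_real s * hs k = complex_of_real (\<rho>\<^sup>2 / \<rho>)"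
      unfolding cs \<rho>(2)
      by (simp add: add_divide_distrib mult.commute power2_eq_square[of "complex_of_real (hs k)"]
          flip: complex_norm_square)
    also have "\<dots> = complex_of_real \<rho>" using \<rho>(1) by (simp add: power2_eq_square)
    finally have diag: "cnj c * ?\<tau> + complex_of_real s * hs k = complex_of_real \<rho>" .
    have red0: "red k Q i j = 0" if "j < k - 1" "i < k" "j < i" for i j
      using Q that by (auto simp: reduced_def)
    have ut: "upper_triangular R"
      by (rule upper_triangularI) (auto simp: R_def P_index red0 E_zero)
    have pos: "R $$ (i, i) \<in> \<real> \<and> 0 < Re (R $$ (i, i))" if "i < k" for i
    proof (cases "i = k - 1")
      case True
      moreover have "k - Suc 0 \<noteq> k" using k by simp
      ultimately show ?thesis
        using k \<rho>(1) diag by (simp add: R_def P_index E_subdiag)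
    next
      case False
      then have "i < k - 1" using that by linarith
      then show ?thesis using Q that False by (auto simp: R_def P_index reduced_def)
    qed
    have "P $$ (k, j) = 0" if "j < k" for j
    proof (cases "j = k - 1")
      case True
      then show ?thesis using r that by (simp add: P_index E_subdiag)
    next
      case False
      then show ?thesis using that k by (simp add: P_index red0 E_zero)
    qed
    then have "P = R @\<^sub>r 0\<^sub>m 1 k"
      using P by (intro eq_matI) (auto simp: append_rows_def R_def less_Suc_eq)
    then show ?L
      unfolding rotation_params_def P_def[symmetric] using r ut pos by (auto simp: R_def intro!: bexI[of _ R])
  qed
qed

section \<open>The QR factors and their parameters\<close>

abbreviation "Qk \<equiv> qr_Q A b \<delta>"
abbreviation "ck \<equiv> qr_c A b \<delta>"
abbreviation "sk \<equiv> qr_s A b \<delta>"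
abbreviation "\<tau> \<equiv> qr_tau A b \<delta>"

text \<open>The product in \<open>rotation_params\<close> consists of the first \<open>k\<close>
  columns of the next reduced matrix, so \<open>R\<close> over a zero row is exactly the invariant
  for size \<open>k + 1\<close>.\<close>

lemma reduced_Suc:
  assumes Q: "Q \<in> carrier_mat k k" and k: "1 \<le> k" and rp: "rotation_params A b \<delta> k Q c s"
  shows "reduced (Suc k) (mat_adjoint (qr_step_adj k Q c s))"
proof -
  define S where "S = qr_step_adj k Q c s"
  have S: "S \<in> carrier_mat (k + 1) (k + 1)" unfolding S_def by (rule qr_step_adj_carrier[OF Q k])
  obtain R where R: "R \<in> carrier_mat k k" "upper_triangular R"
      "\<forall>i < k. R $$ (i, i) \<in> \<real> \<and> 0 < Re (R $$ (i, i))"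
      "S * (hess_under A b k - \<delta> \<cdot>\<^sub>m id_under k) = R @\<^sub>r 0\<^sub>m 1 k"
    using rp unfolding rotation_params_def S_def by blast
  have "red (Suc k) (mat_adjoint S) i j = (if i < k then R $$ (i, j) else 0)" if "i \<le> k" "j < k" for i j
  proof -
    have "red (Suc k) (mat_adjoint S) i j = (\<Sum>l<k + 1. S $$ (i, l) * E l j)"
      unfolding red_def using that S by (intro sum.cong) (auto simp: mat_adjoint_index)
    also have "\<dots> = (S * (hess_under A b k - \<delta> \<cdot>\<^sub>m id_under k)) $$ (i, j)"
      using that S by (simp add: hess_under_shifted scalar_prod_def lessThan_atLeast0 del: sum.op_ivl_Suc)
    finally show ?thesis unfolding R(4) using that R(1) by (simp add: append_rows_def)
  qed
  then show ?thesis
    using R(2,3) mat_adjoint_carrier[OF S] R(1)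
    unfolding reduced_def S_def[symmetric] by (auto simp: upper_triangular_def)
qed

text \<open>The explicit solution yields existence and uniqueness together, as the definite
  description requires. Here \<open>k < N\<close> enters through the positive subdiagonal
  entry.\<close>

lemma the_rotation_params:
  assumes "reduced k Q" "1 \<le> k" "k < N"
  shows "rotation_params A b \<delta> k Q (fst (the_rotation A b \<delta> k Q)) (snd (the_rotation A b \<delta> k Q))"
proof -
  have "\<exists>!x. case x of (c, s) \<Rightarrow> rotation_params A b \<delta> k Q c s"
    unfolding rotation_params_iff[OF assms] rotation_unique[OF hs_pos[OF assms(2,3)]] by auto
  then have "case the_rotation A b \<delta> k Q of (c, s) \<Rightarrow> rotation_params A b \<delta> k Q c s"
    unfolding the_rotation_def by (rule theI')
  then show ?thesis by (simp add: case_prod_beta)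
qed

lemma qr_Q_Suc: "1 \<le> k \<Longrightarrow> Qk (Suc k) = mat_adjoint (qr_step_adj k (Qk k) (ck k) (sk k))"
  by (simp add: qr_Q.simps(2) qr_c_def qr_s_def case_prod_beta)

lemma qr_Q_reduced: "1 \<le> k \<Longrightarrow> k \<le> N \<Longrightarrow> reduced k (Qk k)"
proof (induction k rule: dec_induct)
  case base
  then show ?case by (simp add: qr_Q.simps(2) reduced_def)
next
  case (step k)
  then have "reduced k (Qk k)" by simp
  then show ?case
    using reduced_Suc the_rotation_params step
    by (simp add: qr_Q_Suc qr_c_def qr_s_def reduced_def[of k])
qed

lemma qr_Q_carrier: "1 \<le> k \<Longrightarrow> k \<le> N \<Longrightarrow> Qk k \<in> carrier_mat k k"
  using qr_Q_reduced by (simp add: reduced_def)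

lemma qr_tau_red:
  assumes k: "1 \<le> k" "k \<le> N"
  shows "\<tau> k = red k (Qk k) (k - 1) (k - 1)"
proof -
  define T where "T = mat_adjoint (Qk k) * (hess A b k - \<delta> \<cdot>\<^sub>m 1\<^sub>m k)"
  have a: "mat_adjoint (Qk k) \<in> carrier_mat k k" using mat_adjoint_carrier[OF qr_Q_carrier[OF k]] .
  have T: "T \<in> carrier_mat k k" using a by (simp add: T_def hess_shifted)
  have "\<tau> k = (T *\<^sub>v unit_vec k (k - 1)) $ (k - 1)"
  proof -
    have "conjugate (unit_vec k (k - 1)) = (unit_vec k (k - 1) :: complex vec)"
      by (rule eq_vecI) (auto simp: unit_vec_def)
    moreover have "T *\<^sub>v unit_vec k (k - 1) \<in> carrier_vec k" using T by simp
    ultimately show ?thesis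
      using k scalar_prod_right_unit[of "k - 1" k "T *\<^sub>v unit_vec k (k - 1)"]
      by (simp add: qr_tau_def flip: T_def)
  qed
  also have "\<dots> = T $$ (k - 1, k - 1)"
    using k T by simp
  also have "\<dots> = red k (Qk k) (k - 1) (k - 1)"
    using k a qr_Q_carrier[OF k]
    by (auto simp: T_def hess_shifted scalar_prod_def red_def lessThan_atLeast0 mat_adjoint_index intro!: sum.cong)
  finally show ?thesis .
qed

lemma rotation_eqs:
  assumes k: "1 \<le> k" "k < N"
  shows "0 \<le> sk k \<and> (sk k)\<^sup>2 + (cmod (ck k))\<^sup>2 = 1 \<and> - complex_of_real (sk k) * \<tau> k + ck k * hs k = 0"
  using the_rotation_params[OF qr_Q_reduced k] k rotation_params_iff[OF qr_Q_reduced k]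
  by (simp add: qr_c_def qr_s_def qr_tau_red)

lemma rotation_values:
  assumes k: "1 \<le> k" "k < N"
  shows "ck k = \<tau> k / complex_of_real (sqrt ((hs k)\<^sup>2 + (cmod (\<tau> k))\<^sup>2))"
    and "sk k = hs k / sqrt ((hs k)\<^sup>2 + (cmod (\<tau> k))\<^sup>2)"
  using rotation_eqs[OF k] rotation_unique[OF hs_pos[OF k]] by blast+

section \<open>The directions of the residuals\<close>

definition dir :: "nat \<Rightarrow> complex vec" where
  "dir k = comb k (\<lambda>j. Qk k $$ (j - 1, k - 1))"

lemma dir_carrier [simp]: "dir k \<in> carrier_vec n"
  by (simp add: dir_def)

lemma dim_dir [simp]: "dim_vec (dir k) = n"
  by (simp add: dir_def)

lemma dir_1: "dir 1 = v 1"
  by (auto simp: dir_def comb_def qr_Q.simps(2))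

text \<open>The last column of \<open>Qk (Suc k)\<close> is the conjugated last row of the adjoint
  step: the last column of \<open>Qk k\<close> scaled by \<open>- sk k\<close>, followed by
  \<open>cnj (ck k)\<close>.\<close>

lemma dir_Suc:
  assumes k: "1 \<le> k" "k < N"
  shows "dir (Suc k) = - complex_of_real (sk k) \<cdot>\<^sub>v dir k + cnj (ck k) \<cdot>\<^sub>v v (Suc k)"
proof -
  have Q: "Qk k \<in> carrier_mat k k" using qr_Q_carrier k by simp
  have e: "Qk (Suc k) $$ (j, k) = (if j = k then cnj (ck k) else - complex_of_real (sk k) * Qk k $$ (j, k - 1))"
    if "j \<le> k" for j
    using that qr_step_adj_carrier[OF Q k(1), of "ck k" "sk k"]
    by (simp add: qr_Q_Suc[OF k(1)] mat_adjoint_index qr_step_adj_index[OF Q k(1)])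
  show ?thesis
    unfolding dir_def comb_Suc comb_smult using k(1)
    by (auto simp: e intro!: arg_cong2[of _ _ _ _ "(+)"] comb_cong)
qed

lemma v_cinner_dir: "k < j \<Longrightarrow> v j \<bullet>c dir k = 0"
  unfolding dir_def cinner_comb[OF v_carrier] by (auto intro!: sum.neutral v_orthogonal)

lemma dir_cinner_v: "k < j \<Longrightarrow> dir k \<bullet>c v j = 0"
  using v_cinner_dir[of k j] cinner_cnj[of "dir k" "v j"] by simp

text \<open>The two terms of the recursion are orthogonal, and their squared norms are the squares
  of \<open>sk k\<close> and of the modulus of \<open>ck k\<close>.\<close>

lemma dir_norm: "1 \<le> k \<Longrightarrow> k \<le> N \<Longrightarrow> dir k \<bullet>c dir k = 1"
proof (induction k rule: dec_induct)
  case base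
  then show ?case using v_orthonormal[of 1 1] dir_1 by simp
next
  case (step k)
  then have k: "1 \<le> k" "k < N" by auto
  have "dir (Suc k) \<bullet>c dir (Suc k) = complex_of_real ((sk k)\<^sup>2) * (dir k \<bullet>c dir k)
     + cnj (ck k) * ck k * (v (Suc k) \<bullet>c v (Suc k))"
    by (simp add: dir_Suc[OF k] conjugate_add_vec[of _ n] conjugate_smult_vec
        add_scalar_prod_distrib[of _ n] scalar_prod_add_distrib[of _ n]
        v_cinner_dir dir_cinner_v power2_eq_square)
  also have "\<dots> = complex_of_real ((sk k)\<^sup>2 + (cmod (ck k))\<^sup>2)"
    using step v_orthonormal[of "Suc k" "Suc k"] by (simp add: mult.commute flip: complex_norm_square)
  finally show ?case using rotation_eqs[OF k] by simp
qed

text \<open>Since \<open>v 1\<close> is orthogonal to \<open>v (Suc k)\<close>, each step multiplies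
  the product by \<open>- sk k\<close>, which is strictly negative before termination.\<close>

lemma v_1_cinner_dir:
  "1 \<le> k \<Longrightarrow> k \<le> N \<Longrightarrow> \<exists>p>0. v 1 \<bullet>c dir k = (- 1) ^ (k - 1) * complex_of_real p"
proof (induction k rule: dec_induct)
  case base
  then show ?case using v_orthonormal[of 1 1] dir_1 by (intro exI[of _ 1]) simp
next
  case (step k)
  then have k: "1 \<le> k" "k < N" by auto
  obtain p where p: "p > 0" "v 1 \<bullet>c dir k = (- 1) ^ (k - 1) * complex_of_real p"
    using step by auto
  have "v 1 \<bullet>c dir (Suc k) = - complex_of_real (sk k) * (v 1 \<bullet>c dir k)"
    using v_orthogonal[of 1 "Suc k"] k
    by (simp add: dir_Suc[OF k] conjugate_add_vec[of _ n] conjugate_smult_vec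
        scalar_prod_add_distrib[of _ n])
  also have "\<dots> = (- 1) ^ (Suc k - 1) * complex_of_real (sk k * p)"
    using p(2) k by (cases k) auto
  finally show ?case
    using p(1) rotation_values(2)[OF k] hs_pos[OF k]
    by (intro exI[of _ "sk k * p"]) (simp add: add_pos_nonneg)
qed

text \<open>Expanding \<open>dir k\<close> in the Arnoldi vectors produces an entry of the last row
  of the reduced matrix; zeros of that row thus become orthogonality relations.\<close>

lemma Mv_cinner_dir:
  assumes "1 \<le> j" "j \<le> N"
  shows "(M *\<^sub>v v j) \<bullet>c dir k = red k (Qk k) (k - 1) (j - 1)"
proof -
  have "(M *\<^sub>v v j) \<bullet>c dir k = (\<Sum>i = Suc 0..k. cnj (Qk k $$ (i - 1, k - 1)) * E (i - 1) (j - 1))"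
    unfolding dir_def cinner_comb[OF Mv_carrier]
    by (rule sum.cong) (use Mv_cinner_v assms in auto)
  then show ?thesis by (simp add: sum.atLeast1_atMost_eq red_def)
qed

lemma Mv_cinner_dir_tau: "1 \<le> k \<Longrightarrow> k \<le> N \<Longrightarrow> (M *\<^sub>v v k) \<bullet>c dir k = \<tau> k"
  by (simp add: Mv_cinner_dir qr_tau_red)

lemma M_comb_carrier [simp]: "M *\<^sub>v comb k z \<in> carrier_vec n"
  using M_carrier by simp

lemma M_zero: "M *\<^sub>v 0\<^sub>v n = 0\<^sub>v n"
  by (rule eq_vecI) (auto simp: scalar_prod_def)

lemma M_comb_Suc: "M *\<^sub>v comb (Suc k) z = M *\<^sub>v comb k z + z (Suc k) \<cdot>\<^sub>v (M *\<^sub>v v (Suc k))"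
  using M_carrier by (simp add: comb_Suc mult_add_distrib_mat_vec[of _ n n] mult_mat_vec[of _ n n])

lemma M_comb_cinner_dir: "m < k \<Longrightarrow> k \<le> N \<Longrightarrow> (M *\<^sub>v comb m z) \<bullet>c dir k = 0"
proof (induction m)
  case 0
  then show ?case by (simp add: M_zero)
next
  case (Suc m)
  have "(M *\<^sub>v v (Suc m)) \<bullet>c dir k = 0"
    using Suc qr_Q_reduced[of k] by (auto simp: Mv_cinner_dir reduced_def)
  then show ?case
    using Suc by (simp add: M_comb_Suc add_scalar_prod_distrib[of _ n] smult_scalar_prod_distrib[of _ n])
qed

section \<open>Splitting the Krylov space along the image of the shifted operator\<close>

lemma Mv_comb:
  assumes k: "1 \<le> k"
  shows "M *\<^sub>v v k = comb k (\<lambda>j. E (j - 1) (k - 1)) + hs k \<cdot>\<^sub>v v (Suc k)"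
proof -
  have "comb k (\<lambda>j. h j k) = comb k (\<lambda>j. E (j - 1) (k - 1)) + comb k (\<lambda>j. if j = k then \<delta> else 0)"
    unfolding comb_add by (rule comb_cong) (use k in \<open>auto simp: shifted_entry_def\<close>)
  moreover have "comb k (\<lambda>j. if j = k then \<delta> else 0) = \<delta> \<cdot>\<^sub>v v k"
    using k by (auto simp: comb_def if_distribR if_distrib cong: if_cong)
  ultimately show ?thesis
    unfolding Mv Av_comb[OF k] comb_Suc h_subdiag[OF k] by (intro eq_vecI) auto
qed

text \<open>By \<open>M_comb_cinner_dir\<close>, this is the orthogonal decomposition of \<open>comb k y\<close> with respect to the
  image of the span of \<open>v 1, \<dots>, v (k - 1)\<close> under \<open>M\<close>.\<close>
lemma comb_decomposition:
  "1 \<le> k \<Longrightarrow> k \<le> N \<Longrightarrow> \<exists>z \<gamma>. comb k y = M *\<^sub>v comb (k - 1) z + \<gamma> \<cdot>\<^sub>v dir k"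
proof (induction k arbitrary: y rule: dec_induct)
  case base
  show ?case using M_carrier
    by (intro exI[of _ y] exI[of _ "y 1"]) (auto simp: comb_Suc dir_1[simplified])
next
  case (step k)
  then have k: "1 \<le> k" "k < N" and IH: "\<And>y. \<exists>z \<gamma>. comb k y = M *\<^sub>v comb (k - 1) z + \<gamma> \<cdot>\<^sub>v dir k"
    by auto
  let ?c = "ck k" and ?s = "sk k" and ?d = "dir k" and ?v = "v (Suc k)"
  define \<rho> where "\<rho> = sqrt ((hs k)\<^sup>2 + (cmod (\<tau> k))\<^sup>2)"
  have \<rho>: "0 < \<rho>" using hs_pos[OF k] by (auto simp: \<rho>_def intro!: add_pos_nonneg)
  have \<tau>: "\<tau> k = \<rho> * ?c" and hs: "hs k = \<rho> * ?s"
    using rotation_values[OF k, folded \<rho>_def] \<rho> by auto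
  have ext: "comb (k - 1) z = comb k (\<lambda>j. if j = k then 0 else z j)" for z
    using k(1) comb_Suc[of "k - 1"] comb_cong[of "k - 1" z "\<lambda>j. if j = k then 0 else z j"]
    by auto
  have unit: "v k = comb k (\<lambda>j. if j = k then 1 else 0)"
    using k by (auto simp: comb_def if_distribR if_distrib cong: if_cong)
  obtain z \<gamma> where z: "comb k (\<lambda>j. E (j - 1) (k - 1)) = M *\<^sub>v comb (k - 1) z + \<gamma> \<cdot>\<^sub>v ?d"
    using IH by blast
  have Mvk: "M *\<^sub>v v k = M *\<^sub>v comb (k - 1) z + \<gamma> \<cdot>\<^sub>v ?d + hs k \<cdot>\<^sub>v ?v"
    using Mv_comb[OF k(1)] unfolding z .
  \<comment> \<open>Take the inner product of \<open>Mvk\<close> with \<open>dir k\<close>: the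
    image part and \<open>v (Suc k)\<close> are orthogonal to it.\<close>
  have "\<tau> k = \<gamma>"
    using Mv_cinner_dir_tau[of k] k unfolding Mvk
    by (simp add: add_scalar_prod_distrib[of _ n] M_comb_cinner_dir dir_norm v_cinner_dir)
  \<comment> \<open>The coefficients of \<open>v k - comb (k - 1) z\<close>, chosen so that the
    image under \<open>M\<close> lies in the plane of \<open>dir k\<close> and
    \<open>v (Suc k)\<close>. There it equals \<rho> times the unit vector with coordinates
    \<open>?c\<close> and \<open>?s\<close>.\<close>
  define z' where "z' j = (if j = k then 1 else - z j)" for j
  have "v k = comb (k - 1) z + comb k z'"
    unfolding ext unit comb_add by (rule comb_cong) (auto simp: z'_def)
  then have "M *\<^sub>v v k = M *\<^sub>v comb (k - 1) z + M *\<^sub>v comb k z'"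
    using M_carrier by (simp add: mult_add_distrib_mat_vec[of _ n n])
  then have p: "M *\<^sub>v comb k z' = \<gamma> \<cdot>\<^sub>v ?d + hs k \<cdot>\<^sub>v ?v"
    unfolding Mvk using M_carrier by (auto simp: vec_eq_iff)
  obtain z2 \<gamma>2 where z2: "comb k y = M *\<^sub>v comb (k - 1) z2 + \<gamma>2 \<cdot>\<^sub>v ?d"
    using IH by blast
  \<comment> \<open>The component, along that unit vector, of the part of
    \<open>comb (Suc k) y\<close> lying in the plane; dividing by \<rho> turns it into a multiple of
    \<open>M *\<^sub>v comb k z'\<close>.\<close>
  define e where "e = \<gamma>2 * cnj ?c + y (Suc k) * ?s"
  define w where "w j = (if j = k then 0 else z2 j) + e / \<rho> * z' j" for j
  have "comb k w = comb (k - 1) z2 + (e / \<rho>) \<cdot>\<^sub>v comb k z'"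
    unfolding ext comb_smult comb_add w_def ..
  then have Mw: "M *\<^sub>v comb k w = M *\<^sub>v comb (k - 1) z2 + (e / \<rho>) \<cdot>\<^sub>v (M *\<^sub>v comb k z')"
    using M_carrier by (simp add: mult_add_distrib_mat_vec[of _ n n] mult_mat_vec[of _ n n])
  have "complex_of_real ((?s)\<^sup>2 + (cmod ?c)\<^sup>2) = 1" using rotation_eqs[OF k] by simp
  then have cs: "complex_of_real ?s * ?s + ?c * cnj ?c = 1"
    using complex_norm_square[of ?c] by (simp add: power2_eq_square)
  \<comment> \<open>Expansion in the orthonormal basis of the plane formed by that unit vector and
    \<open>dir (Suc k)\<close>, written for the coordinates \<open>x\<close> of \<open>dir k\<close>
    and \<open>u\<close> of \<open>v (Suc k)\<close>.\<close>
  have "\<gamma>2 * x + y (Suc k) * u = e / \<rho> * (\<gamma> * x + hs k * u)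
      + (?c * y (Suc k) - ?s * \<gamma>2) * (- ?s * x + cnj ?c * u)" for x u :: complex
  proof -
    have "e / \<rho> * (\<gamma> * x + hs k * u) = e * (?c * x + ?s * u)"
      using \<rho> unfolding \<open>\<tau> k = \<gamma>\<close>[symmetric] \<tau> hs by (simp add: field_simps)
    moreover have "e * (?c * x + ?s * u) + (?c * y (Suc k) - ?s * \<gamma>2) * (- ?s * x + cnj ?c * u)
        = (\<gamma>2 * x + y (Suc k) * u) * (complex_of_real ?s * ?s + ?c * cnj ?c)"
      by (simp add: e_def algebra_simps)
    ultimately show ?thesis using cs by simp
  qed
  then have "comb (Suc k) y = M *\<^sub>v comb k w + (?c * y (Suc k) - ?s * \<gamma>2) \<cdot>\<^sub>v dir (Suc k)"
    unfolding comb_Suc z2 Mw p dir_Suc[OF k]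
    by (intro eq_vecI) (simp_all add: add.assoc)
  then show ?case by auto
qed

section \<open>The GMRES residuals\<close>

text \<open>Orthonormality makes \<open>v\<close> injective on \<open>{1..m}\<close>, so linear
  combinations over the set of vectors can be reindexed by numbers; \<open>inv_into\<close>
  transports coefficients in the other direction.\<close>

lemma vec_span_v:
  assumes m: "m \<le> N"
  shows "vec_span n (v ` {1..m}) = range (comb m)"
proof -
  interpret V: vec_space "TYPE(complex)" n .
  have inj: "inj_on v {1..m}"
    using v_orthonormal m by (intro inj_onI) (metis atLeastAtMost_iff le_trans zero_neq_one)
  have W: "v ` {1..m} \<subseteq> carrier_vec n" by auto
  have comb: "V.lincomb a (v ` {1..m}) = comb m (\<lambda>j. a (v j))" for a
    using W by (intro eq_vecI)
      (auto simp: V.lincomb_index V.lincomb_dim comb_def sum.reindex[OF inj[simplified]])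
  have span: "V.span (v ` {1..m}) = {V.lincomb a (v ` {1..m}) | a. True}"
    using V.finite_span[of "v ` {1..m}"] W by auto
  have "comb m y = V.lincomb (y \<circ> inv_into {1..m} v) (v ` {1..m})" for y
    unfolding comb by (rule comb_cong) (simp add: inv_into_f_f[OF inj[simplified]])
  then have "comb m y \<in> range (\<lambda>a. V.lincomb a (v ` {1..m}))" for y by blast
  then have "range (comb m) = range (\<lambda>a. V.lincomb a (v ` {1..m}))" unfolding comb by blast
  then show ?thesis unfolding vec_span_def span by auto
qed

text \<open>In the decomposition of \<open>b\<close>, the part in the image is the orthogonal
  projection and hence the minimizer; what remains is the component along
  \<open>dir k\<close>.\<close>

lemma gmres_res_dir:
  assumes k: "1 \<le> k" "k \<le> N"
  shows "gmres_res A b \<delta> (k - 1) = (b \<bullet>c dir k) \<cdot>\<^sub>v dir k"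
proof -
  let ?S = "(*\<^sub>v) M ` vec_span (dim_vec b) (v ` {1..k - 1})"
  have S: "?S = range (\<lambda>z. M *\<^sub>v comb (k - 1) z)"
    using vec_span_v[of "k - 1"] k b by auto
  have "comb k (\<lambda>j. if j = 1 then complex_of_real (euclid_norm b) else 0)
      = complex_of_real (euclid_norm b) \<cdot>\<^sub>v v 1"
    using k by (auto simp: comb_def if_distribR if_distrib cong: if_cong)
  then have "b = comb k (\<lambda>j. if j = 1 then complex_of_real (euclid_norm b) else 0)"
    using b_v_1 by simp
  then obtain z \<gamma> where z: "b = M *\<^sub>v comb (k - 1) z + \<gamma> \<cdot>\<^sub>v dir k"
    using comb_decomposition[OF k] by metis
  have \<gamma>: "b \<bullet>c dir k = \<gamma>"
    by (subst z) (use k in \<open>simp add: add_scalar_prod_distrib[of _ n] M_comb_cinner_dir dir_norm\<close>)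
  define u where "u = M *\<^sub>v comb (k - 1) z"
  have u: "u \<in> carrier_vec n" by (simp add: u_def)
  have bu: "b - u = \<gamma> \<cdot>\<^sub>v dir k" by (subst z) (use u in \<open>auto simp: u_def vec_eq_iff\<close>)
  show ?thesis
  \<comment> \<open>The residual with index 0 is \<open>b\<close> by definition, without a
    minimization; in this case \<open>u\<close> is the image of the empty combination, which is
    zero.\<close>
  proof (cases "k = 1")
    case True
    then show ?thesis using bu b \<gamma> by (simp add: gmres_res_def u_def M_zero)
  next
    case False
    have "arg_min (\<lambda>x. euclid_norm (b - x)) (\<lambda>x. x \<in> ?S) = u"
    proof (rule arg_min_orthogonal[OF b])
      show "?S \<subseteq> carrier_vec n" "u \<in> ?S" unfolding S u_def by auto
      fix x assume "x \<in> ?S"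
      then obtain w where "x = M *\<^sub>v comb (k - 1) w" unfolding S by auto
      \<comment> \<open>Both \<open>u\<close> and \<open>x\<close> lie in the image, each orthogonal
        to \<open>dir k\<close>, and \<open>b - u\<close> is a multiple of
        \<open>dir k\<close>.\<close>
      then show "(u - x) \<bullet>c (b - u) = 0"
        unfolding bu unfolding u_def using k
        by (simp add: minus_scalar_prod_distrib[of _ n] conjugate_smult_vec M_comb_cinner_dir)
    qed
    then show ?thesis using False k \<gamma> bu by (simp add: gmres_res_def)
  qed
qed

text \<open>As \<open>b\<close> is a positive multiple of \<open>v 1\<close>, its product with
  \<open>dir k\<close> is a positive number \<open>q\<close> times the alternating sign; normalizing
  removes \<open>q\<close> and keeps the sign.\<close>

lemma gmres_w_dir:
  assumes k: "1 \<le> k" "k \<le> N"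
  shows "gmres_w A b \<delta> (k - 1) = (- 1) ^ (k - 1) \<cdot>\<^sub>v dir k"
proof -
  obtain p where p: "p > 0" "v 1 \<bullet>c dir k = (- 1) ^ (k - 1) * complex_of_real p"
    using v_1_cinner_dir[OF k] by auto
  define q where "q = euclid_norm b * p"
  have "euclid_norm b \<noteq> 0" using euclid_norm_eq_0[OF A b b] b_nz by simp
  then have q: "q > 0" using p(1) euclid_norm_nonneg[of b] by (simp add: q_def)
  have bd: "b \<bullet>c dir k = (- 1) ^ (k - 1) * complex_of_real q"
    by (subst b_v_1) (simp add: p(2)[simplified] q_def)
  have "euclid_norm (dir k) = 1"
    using dir_norm[OF k] cinner_self[OF A b dir_carrier, of k] euclid_norm_nonneg[of "dir k"]
    by (simp add: power2_eq_1_iff flip: of_real_power)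
  then show ?thesis
    unfolding gmres_w_def gmres_res_dir[OF k] normalize_vec_def euclid_norm_smult bd
    using q by (simp add: smult_smult_assoc norm_mult norm_power)
qed

lemma tau_gmres:
  assumes k: "1 \<le> k" "k \<le> N"
  shows "\<tau> k = (- 1) ^ (k - 1) * ((M *\<^sub>v v k) \<bullet>c gmres_w A b \<delta> (k - 1))"
  unfolding gmres_w_dir[OF k]
  by (simp add: conjugate_smult_vec scalar_prod_smult_distrib[of _ n] Mv_cinner_dir_tau[OF k] flip: mult.assoc power_mult_distrib)

text \<open>The radicand has complex type but is a nonnegative real, where the principal root agrees
  with the real one.\<close>

lemma csqrt_h:
  assumes "1 \<le> k"
  shows "csqrt ((h (k + 1) k)\<^sup>2 + complex_of_real ((cmod (\<tau> k))\<^sup>2))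
    = complex_of_real (sqrt ((hs k)\<^sup>2 + (cmod (\<tau> k))\<^sup>2))"
  using h_subdiag[OF assms] csqrt_of_real_nonneg[of "(hs k)\<^sup>2 + (cmod (\<tau> k))\<^sup>2"] by simp

end

theorem proposition2p10:
  fixes A :: "complex mat" and b :: "complex vec" and \<delta> :: complex and n k :: nat
  assumes "A \<in> carrier_mat n n"
    and "b \<in> carrier_vec n"
    and "b \<noteq> 0\<^sub>v n"
    and "1 \<le> k"
    and "k \<le> arnoldi_index A b - 1"
  shows "qr_tau A b \<delta> k
           = (- 1) ^ (k - 1) * ((shifted A \<delta> *\<^sub>v arnoldi_vec A b k) \<bullet>c gmres_w A b \<delta> (k - 1))
       \<and> complex_of_real (qr_s A b \<delta> k)
           = arnoldi_h A b (k + 1) k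
             / csqrt ((arnoldi_h A b (k + 1) k)\<^sup>2 + complex_of_real ((cmod (qr_tau A b \<delta> k))\<^sup>2))
       \<and> qr_c A b \<delta> k
           = qr_tau A b \<delta> k
             / csqrt ((arnoldi_h A b (k + 1) k)\<^sup>2 + complex_of_real ((cmod (qr_tau A b \<delta> k))\<^sup>2))"
proof -
  interpret shifted_arnoldi A b \<delta> n using assms by unfold_locales
  have k: "1 \<le> k" "k < N" using assms(4,5) by auto
  show ?thesis
    unfolding csqrt_h[OF k(1)]
    using tau_gmres[of k] rotation_values[OF k] h_subdiag[OF k(1)] k by simp
qed

end
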